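(* Let $X=[0,1)\cap\mathbb{Q}$ with its usual order $\prec$, and let $\mathbf{B}$ be the Boolean algebra of good subsets of $X$ (defined below). Let $e\colon X\cup\{1\}\to\omega$ be a finite-to-one function, and define $\mathrm{int}$ and $\mathrm{osc}$ as below. Then for every countable atomless Boolean subalgebra $\mathbf{C}$ of $\mathbf{B}$ and every integer $n>0$ there exist $a,b\in\mathbf{C}$ such that $a\cap b=\emptyset$, $0\notin a\cup b$, and $\mathrm{osc}(a,b)=n$.
   Context: Each integer $n\ge 0$ is identified with the set $\{0,\dots,n-1\}$, and $\omega$ denotes the set of non-negative integers. A set $a\subseteq X$ is called good if there exist $n<\omega$ and a strictly increasing function $\mathrm{seq}_a\colon 2n\to X\cup\{1\}$ such that for every $x\in X$: $x\in a$ if and only if there is $i<n$ with $\mathrm{seq}_a(2i)\preceq x\prec \mathrm{seq}_a(2i+1)$ (i.e. $a$ is a finite union of separated half-open intervals $[\mathrm{seq}_a(2i),\mathrm{seq}_a(2i+1))$; this $\mathrm{seq}_a$ is uniquely determined by $a$). The set $\mathbf{B}$ of all good subsets of $X$ is a Boolean subalgebra of the power set of $X$ (it is a countable atomless Boolean algebra). For $a\in\mathbf{B}$, put $\mathrm{int}(a)=\{e(u): u\in\mathrm{Im}(\mathrm{seq}_a)\}$, a finite subset of $\omega$. For $a_0,a_1\in\mathbf{B}$ and $i<\omega$, say $a_0$ and $a_1$ oscillate at $i$ if there is $k\in\{0,1\}$ such that: (1) $i\in\mathrm{int}(a_k)\setminus\mathrm{int}(a_{1-k})$, and (2) if the set $S=\{j<i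 : j\in \mathrm{int}(a_k)\,\triangle\,\mathrm{int}(a_{1-k})\}$ is non-empty and $j=\max S$, then $j\in\mathrm{int}(a_{1-k})\setminus\mathrm{int}(a_k)$. Here $\triangle$ is symmetric difference. Define $\mathrm{osc}(a_0,a_1)$ to be the number of $i<\omega$ at which $a_0$ and $a_1$ oscillate. *)

theory Defs
  imports "HOL-Analysis.Sigma_Algebra"
begin

definition X :: "rat set" where
  "X = {0..<1}"

(* A strictly increasing function 2n -> X \<union> {1} is given by the list of its values. *)
definition represents :: "rat list \<Rightarrow> rat set \<Rightarrow> bool" where
  "represents s a \<longleftrightarrow>
     (\<exists>n. length s = 2 * n \<and> sorted_wrt (<) s \<and> set s \<subseteq> X \<union> {1} \<and>
          (\<forall>x\<in>X. x \<in> a \<longleftrightarrow> (\<exists>i<n. s ! (2 * i) \<le> x \<and> x < s ! (2 * i + 1))))"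

definition good :: "rat set \<Rightarrow> bool" where
  "good a \<longleftrightarrow> a \<subseteq> X \<and> (\<exists>s. represents s a)"

definition good_sets :: "rat set set" where
  "good_sets = {a. good a}"

definition seq_of :: "rat set \<Rightarrow> rat list" where
  "seq_of a = (THE s. represents s a)"

lemma interval_union_iff_odd:
  fixes s :: "rat list"
  assumes "length s = 2 * n" "sorted_wrt (<) s"
  shows "(\<exists>i<n. s ! (2 * i) \<le> x \<and> x < s ! (2 * i + 1)) \<longleftrightarrow> odd (card {u \<in> set s. u \<le> x})"
  using assms
proof (induction n arbitrary: s)
  case 0
  then show ?case by simp
next
  case (Suc n)
  then obtain p q t where s: "s = p # q # t"
    by (cases s; cases "tl s") auto
  have t: "length t = 2 * n" "sorted_wrt (<) t"
    and pq: "p < q" "\<forall>u\<in>set t. q < u"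
    using Suc.prems s by auto
  let ?T = "{u \<in> set t. u \<le> x}"
  have split: "(\<exists>i<Suc n. s ! (2 * i) \<le> x \<and> x < s ! (2 * i + 1)) \<longleftrightarrow>
      (p \<le> x \<and> x < q) \<or> (\<exists>i<n. t ! (2 * i) \<le> x \<and> x < t ! (2 * i + 1))"
    by (subst Ex_less_Suc2) (simp add: s)
  consider "x < p" | "p \<le> x" "x < q" | "q \<le> x" by linarith
  then show ?case
  proof cases
    case 1
    then have eq: "{u \<in> set s. u \<le> x} = ?T" using pq s by auto
    show ?thesis unfolding split eq using Suc.IH[OF t] 1 by simp
  next
    case 2
    then have "{u \<in> set s. u \<le> x} = {p}" using pq s by force
    then show ?thesis using split 2 by simp
  next
    case 3
    then have eq: "{u \<in> set s. u \<le> x} = insert p (insert q ?T)" using pq s by force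
    have "p \<notin> insert q ?T" "q \<notin> ?T" using pq by auto
    then have "card {u \<in> set s. u \<le> x} = Suc (Suc (card ?T))" unfolding eq by simp
    then show ?thesis using split Suc.IH[OF t] 3 by simp
  qed
qed

lemma represents_unique:
  assumes "represents s a" "represents t a"
  shows "s = t"
proof -
  obtain m where s: "length s = 2 * m" "sorted_wrt (<) s" "set s \<subseteq> X \<union> {1}"
    "\<forall>x\<in>X. x \<in> a \<longleftrightarrow> (\<exists>i<m. s ! (2 * i) \<le> x \<and> x < s ! (2 * i + 1))"
    using assms(1) unfolding represents_def by blast
  obtain n where t: "length t = 2 * n" "sorted_wrt (<) t" "set t \<subseteq> X \<union> {1}"
    "\<forall>x\<in>X. x \<in> a \<longleftrightarrow> (\<exists>i<n. t ! (2 * i) \<le> x \<and> x < t ! (2 * i + 1))"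
    using assms(2) unfolding represents_def by blast
  have st: "distinct s" "distinct t" "sorted s" "sorted t"
    using s(2) t(2) by (auto simp: strict_sorted_iff)
  have par: "even (card {u \<in> set s. u \<le> x}) = even (card {u \<in> set t. u \<le> x})" if "x \<in> X \<union> {1}" for x
  proof (cases "x = 1")
    case True
    have "{u \<in> set s. u \<le> 1} = set s" "{u \<in> set t. u \<le> 1} = set t"
      using s(3) t(3) by (auto simp: X_def)
    then show ?thesis using True st s(1) t(1) by (simp add: distinct_card)
  next
    case False
    then have "x \<in> X" using that by simp
    have "x \<in> a \<longleftrightarrow> odd (card {u \<in> set s. u \<le> x})"
      using bspec[OF s(4) \<open>x \<in> X\<close>] interval_union_iff_odd[OF s(1,2), of x] by (rule trans)
    moreover have "x \<in> a \<longleftrightarrow> odd (card {u \<in> set t. u \<le> x})"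
      using bspec[OF t(4) \<open>x \<in> X\<close>] interval_union_iff_odd[OF t(1,2), of x] by (rule trans)
    ultimately show ?thesis by argo
  qed
  have "set s = set t"
  proof (rule ccontr)
    define D where "D = (set s - set t) \<union> (set t - set s)"
    assume "set s \<noteq> set t"
    then have D: "finite D" "D \<noteq> {}" unfolding D_def by auto
    define d where "d = Min D"
    have d: "d \<in> D" "\<And>u. u < d \<Longrightarrow> u \<notin> D"
      using D unfolding d_def by (auto simp: Min_le leD)
    have agree: "{u \<in> set s. u < d} = {u \<in> set t. u < d}"
      using d(2) unfolding D_def by blast
    have le: "{u \<in> A. u \<le> d} = (if d \<in> A then insert d {u \<in> A. u < d} else {u \<in> A. u < d})" for A
      by (auto simp: order_le_less)
    have "d \<in> X \<union> {1}" using d(1) s(3) t(3) unfolding D_def by blast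
    from par[OF this] show False
      using d(1) unfolding D_def le by (auto simp: agree)
  qed
  then show ?thesis using st by (simp add: sorted_distinct_set_unique)
qed

lemma seq_of_eq: "represents s a \<Longrightarrow> seq_of a = s"
  unfolding seq_of_def by (blast intro: the_equality represents_unique)

definition finite_to_one_on :: "'a set \<Rightarrow> ('a \<Rightarrow> 'b) \<Rightarrow> bool" where
  "finite_to_one_on A f \<longleftrightarrow> (\<forall>y. finite {x \<in> A. f x = y})"

definition int_of :: "(rat \<Rightarrow> nat) \<Rightarrow> rat set \<Rightarrow> nat set" where
  "int_of e a = e ` set (seq_of a)"

(* The oscillation condition for a fixed k, with A = int(a_k) and B = int(a_{1-k}). *)
definition oscillates_from :: "nat set \<Rightarrow> nat set \<Rightarrow> nat \<Rightarrow> bool" where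
  "oscillates_from A B i \<longleftrightarrow>
     i \<in> A - B \<and>
     (let S = {j. j < i \<and> j \<in> sym_diff A B} in S \<noteq> {} \<longrightarrow> Max S \<in> B - A)"

definition oscillate_at :: "(rat \<Rightarrow> nat) \<Rightarrow> rat set \<Rightarrow> rat set \<Rightarrow> nat \<Rightarrow> bool" where
  "oscillate_at e a b i \<longleftrightarrow>
     oscillates_from (int_of e a) (int_of e b) i \<or> oscillates_from (int_of e b) (int_of e a) i"

definition osc :: "(rat \<Rightarrow> nat) \<Rightarrow> rat set \<Rightarrow> rat set \<Rightarrow> nat" where
  "osc e a b = card {i. oscillate_at e a b i}"

definition atom_of :: "'a set set \<Rightarrow> 'a set \<Rightarrow> bool" where
  "atom_of C a \<longleftrightarrow> a \<in> C \<and> a \<noteq> {} \<and> (\<forall>b\<in>C. b \<subseteq> a \<longrightarrow> b = {} \<or> b = a)"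

definition atomless :: "'a set set \<Rightarrow> bool" where
  "atomless C \<longleftrightarrow> (\<nexists>a. atom_of C a)"

end

theory Submission
  imports Defs
begin

text \<open>The endpoints of a good set are the points where its indicator function jumps, so modulo 2
  they depend additively on the set: the endpoint set of a symmetric difference is the symmetric
  difference of the endpoint sets. Below a nonempty element of an atomless algebra there are
  infinitely many elements, so two of them have the same endpoints inside any prescribed finite set;
  their symmetric difference has none there. Since \<open>e\<close> is finite-to-one, one thus finds pairwise
  disjoint nonempty \<open>c\<^sub>1, c\<^sub>2, \<dots>\<close> in the algebra such that all of \<open>int(c\<^sub>k\<^sub>+\<^sub>1)\<close>
  lies above \<open>int(c\<^sub>k)\<close>. Then \<open>c\<^sub>1 \<union> c\<^sub>3 \<union> \<dots>\<close> and \<open>c\<^sub>2 \<union> c\<^sub>4 \<union> \<dots>\<close>, taken up to index \<open>n\<close>, oscillate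
  exactly at the \<open>n\<close> minima of the sets \<open>int(c\<^sub>k)\<close>.\<close>

section \<open>Endpoint sets and their additivity modulo 2\<close>

lemma represents_iff_odd:
  "represents s a \<longleftrightarrow>
     even (length s) \<and> sorted_wrt (<) s \<and> set s \<subseteq> X \<union> {1} \<and>
     (\<forall>x\<in>X. x \<in> a \<longleftrightarrow> odd (card {u \<in> set s. u \<le> x}))"
proof
  assume "represents s a"
  then show "even (length s) \<and> sorted_wrt (<) s \<and> set s \<subseteq> X \<union> {1} \<and>
     (\<forall>x\<in>X. x \<in> a \<longleftrightarrow> odd (card {u \<in> set s. u \<le> x}))"
    unfolding represents_def using interval_union_iff_odd by auto
next
  assume *: "even (length s) \<and> sorted_wrt (<) s \<and> set s \<subseteq> X \<union> {1} \<and>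
     (\<forall>x\<in>X. x \<in> a \<longleftrightarrow> odd (card {u \<in> set s. u \<le> x}))"
  then obtain n where n: "length s = 2 * n" by (auto elim: evenE)
  show "represents s a"
    unfolding represents_def
    using * n interval_union_iff_odd[OF n] by (intro exI[of _ n]) simp
qed

lemma even_card_sym_diff:
  assumes "finite A" "finite B"
  shows "even (card (sym_diff A B)) \<longleftrightarrow> (even (card A) \<longleftrightarrow> even (card B))"
proof -
  have "card (sym_diff A B) = card (A - B) + card (B - A)"
    using assms by (intro card_Un_disjoint) auto
  moreover have "card A = card (A - B) + card (A \<inter> B)"
    using assms by (subst card_Un_disjoint[symmetric]) (auto intro: arg_cong[where f = card])
  moreover have "card B = card (B - A) + card (A \<inter> B)"
    using assms by (subst card_Un_disjoint[symmetric]) (auto intro: arg_cong[where f = card])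
  ultimately show ?thesis by presburger
qed

text \<open>Membership of a point \<open>x\<close> of \<open>X\<close> is the parity of the number
  of endpoints up to \<open>x\<close>, and cardinalities of finite sets add modulo 2 under symmetric
  difference.\<close>

lemma represents_sym_diff:
  assumes "represents s a" "represents t b"
  shows "represents (sorted_list_of_set (sym_diff (set s) (set t))) (sym_diff a b)"
proof -
  let ?D = "sym_diff (set s) (set t)"
  have s: "even (card (set s))" "set s \<subseteq> X \<union> {1}"
    "\<And>x. x \<in> X \<Longrightarrow> x \<in> a \<longleftrightarrow> odd (card {u \<in> set s. u \<le> x})"
    using assms(1) by (auto simp: represents_iff_odd strict_sorted_iff distinct_card)
  have t: "even (card (set t))" "set t \<subseteq> X \<union> {1}"
    "\<And>x. x \<in> X \<Longrightarrow> x \<in> b \<longleftrightarrow> odd (card {u \<in> set t. u \<le> x})"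
    using assms(2) by (auto simp: represents_iff_odd strict_sorted_iff distinct_card)
  have "x \<in> sym_diff a b \<longleftrightarrow> odd (card {u \<in> ?D. u \<le> x})" if "x \<in> X" for x
  proof -
    have "{u \<in> ?D. u \<le> x} = sym_diff {u \<in> set s. u \<le> x} {u \<in> set t. u \<le> x}" by auto
    then show ?thesis
      using even_card_sym_diff[of "{u \<in> set s. u \<le> x}" "{u \<in> set t. u \<le> x}"] s(3) t(3) that
      by auto
  qed
  moreover have "even (card ?D)" using even_card_sym_diff s(1) t(1) by blast
  ultimately show ?thesis
    using s(2) t(2) by (auto simp: represents_iff_odd)
qed

lemma represents_seq_of: "good a \<Longrightarrow> represents (seq_of a) a"
  unfolding good_def using seq_of_eq by auto

lemma set_seq_of_sym_diff:
  assumes "good a" "good b"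
  shows "set (seq_of (sym_diff a b)) = sym_diff (set (seq_of a)) (set (seq_of b))"
  using seq_of_eq[OF represents_sym_diff[OF represents_seq_of[OF assms(1)] represents_seq_of[OF assms(2)]]]
  by simp

lemma seq_of_empty [simp]: "seq_of {} = []"
  by (rule seq_of_eq) (simp add: represents_iff_odd)

lemma int_of_empty [simp]: "int_of e {} = {}"
  by (simp add: int_of_def)

lemma finite_int_of [simp]: "finite (int_of e a)"
  by (simp add: int_of_def)

lemma int_of_nonempty:
  assumes "good a" "a \<noteq> {}"
  shows "int_of e a \<noteq> {}"
proof
  assume "int_of e a = {}"
  then have "represents [] a"
    using represents_seq_of[OF assms(1)] by (simp add: int_of_def)
  then show False
    using assms by (auto simp: represents_iff_odd good_def)
qed

text \<open>No endpoint is negative, so an odd count of endpoints up to 0 forces 0 itself to be one.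
  This turns the requirement of omitting 0 into the avoidance of one endpoint.\<close>

lemma zero_in_imp_endpoint:
  assumes "good a" "0 \<in> a"
  shows "0 \<in> set (seq_of a)"
proof -
  have r: "set (seq_of a) \<subseteq> X \<union> {1}" "odd (card {u \<in> set (seq_of a). u \<le> 0})"
    using represents_seq_of[OF assms(1)] assms(2) by (auto simp: represents_iff_odd X_def)
  then obtain u where "u \<in> set (seq_of a)" "u \<le> 0"
    by (metis (mono_tags, lifting) card.empty empty_Collect_eq even_zero)
  moreover from this have "u = 0" using r(1) by (auto simp: X_def)
  ultimately show ?thesis by simp
qed

text \<open>Disjoint \<open>int_of\<close> sets force disjoint endpoint sets, so no endpoint cancels
  when the union is taken as a symmetric difference.\<close>

lemma int_of_disjoint_Un:
  assumes "good a" "good b" "a \<inter> b = {}" "int_of e a \<inter> int_of e b = {}"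
  shows "int_of e (a \<union> b) = int_of e a \<union> int_of e b"
proof -
  have "sym_diff a b = a \<union> b" using assms(3) by blast
  moreover have "sym_diff (set (seq_of a)) (set (seq_of b)) = set (seq_of a) \<union> set (seq_of b)"
    using assms(4) by (auto simp: int_of_def)
  ultimately show ?thesis
    using set_seq_of_sym_diff[OF assms(1,2)] by (simp add: int_of_def image_Un)
qed

section \<open>Small elements of an atomless algebra\<close>

lemma infinite_below_if_atomless:
  assumes "atomless C" "d \<in> C" "d \<noteq> {}"
  shows "infinite {c \<in> C. c \<subseteq> d}"
proof
  assume "finite {c \<in> C. c \<subseteq> d}"
  then have "finite {c \<in> C. c \<subseteq> d \<and> c \<noteq> {}}"
    by (rule rev_finite_subset) auto
  moreover have "{c \<in> C. c \<subseteq> d \<and> c \<noteq> {}} \<noteq> {}" using assms by auto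
  \<comment> \<open>A minimal nonempty element below \<open>d\<close> would be an atom.\<close>
  ultimately obtain m where "m \<in> {c \<in> C. c \<subseteq> d \<and> c \<noteq> {}}"
    "\<forall>c \<in> {c \<in> C. c \<subseteq> d \<and> c \<noteq> {}}. c \<subseteq> m \<longrightarrow> m = c"
    by (meson finite_has_minimal)
  then have "atom_of C m" unfolding atom_of_def by blast
  then show False using assms(1) unfolding atomless_def by blast
qed

lemma exists_subset_avoiding_endpoints:
  assumes C: "algebra X C" "C \<subseteq> good_sets" "atomless C"
    and d: "d \<in> C" "d \<noteq> {}" and F: "finite F"
  shows "\<exists>c\<in>C. c \<subset> d \<and> c \<noteq> {} \<and> set (seq_of c) \<inter> F = {}"
proof -
  interpret algebra X C by (fact C(1))
  \<comment> \<open>Working below \<open>d'\<close> makes the element found a proper subset of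
    \<open>d\<close>, so that room remains for later blocks.\<close>
  obtain d' where d': "d' \<in> C" "d' \<noteq> {}" "d' \<subset> d"
    using C(3) d unfolding atomless_def atom_of_def by blast
  let ?f = "\<lambda>c. set (seq_of c) \<inter> F"
  \<comment> \<open>Pigeonhole: infinitely many elements lie below \<open>d'\<close>, but their
    endpoint sets have only finitely many traces on \<open>F\<close>. Equal traces cancel in the
    symmetric difference.\<close>
  have "\<not> inj_on ?f {c \<in> C. c \<subseteq> d'}"
  proof
    assume "inj_on ?f {c \<in> C. c \<subseteq> d'}"
    moreover have "?f ` {c \<in> C. c \<subseteq> d'} \<subseteq> Pow F" by blast
    ultimately show False
      using infinite_below_if_atomless[OF C(3) d'(1,2)] F
      by (meson finite_Pow_iff inj_on_finite)
  qed
  then obtain p q where pq: "p \<in> C" "q \<in> C" "p \<subseteq> d'" "q \<subseteq> d'" "p \<noteq> q" "?f p = ?f q"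
    unfolding inj_on_def by blast
  have "good p" "good q" using pq C(2) by (auto simp: good_sets_def)
  then have "set (seq_of (sym_diff p q)) \<inter> F = {}"
    using pq(6) by (auto simp: set_seq_of_sym_diff)
  moreover have "sym_diff p q \<in> C" using pq by blast
  moreover have "sym_diff p q \<subset> d" "sym_diff p q \<noteq> {}" using pq d' by auto
  ultimately show ?thesis by blast
qed

lemma exists_subset_int_of_above:
  assumes e: "finite_to_one_on (X \<union> {1}) e"
    and C: "algebra X C" "C \<subseteq> good_sets" "atomless C"
    and d: "d \<in> C" "d \<noteq> {}"
  shows "\<exists>c\<in>C. c \<subset> d \<and> c \<noteq> {} \<and> 0 \<notin> c \<and> (\<forall>k\<in>int_of e c. m < k)"
proof -
  \<comment> \<open>Only finitely many points have value at most \<open>m\<close>, so all of them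
    can be avoided as endpoints; 0 joins them to keep 0 out of \<open>c\<close>.\<close>
  have "{x \<in> X \<union> {1}. e x \<le> m} = (\<Union>y\<le>m. {x \<in> X \<union> {1}. e x = y})" by auto
  then have "finite {x \<in> X \<union> {1}. e x \<le> m}"
    using e unfolding finite_to_one_on_def by simp
  then obtain c where c: "c \<in> C" "c \<subset> d" "c \<noteq> {}"
    "set (seq_of c) \<inter> insert 0 {x \<in> X \<union> {1}. e x \<le> m} = {}"
    using exists_subset_avoiding_endpoints[OF C d, of "insert 0 {x \<in> X \<union> {1}. e x \<le> m}"] by auto
  have g: "good c" using c(1) C(2) by (auto simp: good_sets_def)
  have "0 \<notin> c" using zero_in_imp_endpoint[OF g] c(4) by blast
  moreover have "set (seq_of c) \<subseteq> X \<union> {1}"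
    using represents_seq_of[OF g] by (simp add: represents_iff_odd)
  then have "\<forall>k\<in>int_of e c. m < k" using c(4) by (force simp: int_of_def)
  ultimately show ?thesis using c by blast
qed

section \<open>Oscillation points and building the pair block by block\<close>

definition osc_points :: "nat set \<Rightarrow> nat set \<Rightarrow> nat set" where
  "osc_points A B = {i. oscillates_from A B i \<or> oscillates_from B A i}"

lemma osc_eq_card_osc_points: "osc e a b = card (osc_points (int_of e a) (int_of e b))"
  by (simp add: osc_def oscillate_at_def osc_points_def)

lemma osc_points_subset: "osc_points A B \<subseteq> A \<union> B"
  by (auto simp: osc_points_def oscillates_from_def)

text \<open>The last difference before \<open>Min K\<close>, if any, is on the \<open>A\<close>
  side, so entering \<open>K\<close> on the \<open>B\<close> side is one new oscillation. Later
  points of \<open>K\<close> follow a difference on their own side, and old points do not see what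
  lies above them.\<close>

lemma osc_points_append_block:
  assumes fin: "finite K" and K: "K \<noteq> {}" and AB: "A \<inter> B = {}"
    and mx: "A \<union> B \<noteq> {} \<longrightarrow> Max (A \<union> B) \<in> A"
    and above: "\<And>j k. j \<in> A \<union> B \<Longrightarrow> k \<in> K \<Longrightarrow> j < k"
  shows "osc_points (B \<union> K) A = insert (Min K) (osc_points A B)"
proof -
  have disj: "K \<inter> A = {}" "K \<inter> B = {}" using above by blast+
  have MinK: "Min K \<in> K" "\<And>k. k \<in> K \<Longrightarrow> Min K \<le> k" using fin K by auto
  have S: "{j. j < i \<and> j \<in> sym_diff (B \<union> K) A} = {j. j < i \<and> j \<in> sym_diff B A}"
    if "i \<le> Min K" for i
    using that MinK disj by force
  have old: "i \<in> osc_points (B \<union> K) A \<longleftrightarrow> i \<in> osc_points A B" if "i \<in> A \<union> B" for i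
  proof -
    have lt: "i < Min K" "i \<notin> K" using above[OF that] MinK by auto
    have eq: "{j. j < i \<and> j \<in> sym_diff (B \<union> K) A} = {j. j < i \<and> j \<in> sym_diff B A}"
      using S lt by simp
    define T where "T = {j. j < i \<and> j \<in> sym_diff B A}"
    have T1: "{j. j < i \<and> j \<in> sym_diff A B} = T" "{j. j < i \<and> j \<in> sym_diff A (B \<union> K)} = T"
       "{j. j < i \<and> j \<in> sym_diff (B \<union> K) A} = T" "{j. j < i \<and> j \<in> sym_diff B A} = T"
      using eq unfolding T_def by blast+
    \<comment> \<open>Passing from \<open>B\<close> to \<open>B \<union> K\<close> could change the
      condition on \<open>Max T\<close> only if \<open>Max T\<close> were in
      \<open>K\<close>.\<close>
    have "Max T \<notin> K" if "T \<noteq> {}"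
    proof -
      have "Max T \<in> T" using that by (intro Max_in) (auto simp: T_def)
      then have "Max T < Min K" using lt unfolding T_def by auto
      then show ?thesis using MinK(2) leD by blast
    qed
    then show ?thesis
      unfolding osc_points_def oscillates_from_def Let_def mem_Collect_eq T1
      using lt by auto
  qed
  have new: "Min K \<in> osc_points (B \<union> K) A"
  proof -
    \<comment> \<open>Disjointness makes all of \<open>A \<union> B\<close> count as earlier
      differences. If it is empty, the second oscillation condition is vacuous.\<close>
    have eq: "{j. j < Min K \<and> j \<in> sym_diff (B \<union> K) A} = A \<union> B"
      using S[of "Min K"] above MinK AB by auto
    have "oscillates_from (B \<union> K) A (Min K)"
      unfolding oscillates_from_def Let_def eq using mx MinK disj AB by auto
    then show ?thesis by (simp add: osc_points_def)
  qed
  have rest: "i \<notin> osc_points (B \<union> K) A" if i: "i \<in> K" "i \<noteq> Min K" for i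
  proof -
    let ?S = "{j. j < i \<and> j \<in> sym_diff (B \<union> K) A}"
    have lt: "Min K < i" using MinK i by (simp add: order_less_le)
    have fS: "finite ?S" by simp
    \<comment> \<open>\<open>Min K\<close> is already an earlier difference, so the last one is at
      least \<open>Min K\<close> and lies above all of \<open>A\<close>.\<close>
    have "Min K \<in> ?S" using lt MinK disj by auto
    then have S_ne: "?S \<noteq> {}" and le: "Min K \<le> Max ?S" using fS Max_ge by blast+
    have "Max ?S \<notin> A" using le above MinK(1) by (meson UnI1 leD)
    then have "\<not> oscillates_from (B \<union> K) A i"
      unfolding oscillates_from_def Let_def using S_ne by blast
    moreover have "\<not> oscillates_from A (B \<union> K) i"
      using i disj by (auto simp: oscillates_from_def)
    ultimately show ?thesis by (simp add: osc_points_def)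
  qed
  show ?thesis
    using old new rest osc_points_subset[of "B \<union> K" A] osc_points_subset[of A B] by blast
qed

text \<open>The two sets swap roles after each step, so that the next block always goes to the second one;
  \<open>d\<close> is the room left for later blocks.\<close>

lemma exists_disjoint_pair_osc:
  assumes e: "finite_to_one_on (X \<union> {1}) e"
    and C: "algebra X C" "C \<subseteq> good_sets" "atomless C"
  shows "\<exists>a b d. a \<in> C \<and> b \<in> C \<and> d \<in> C \<and> d \<noteq> {} \<and>
    a \<inter> b = {} \<and> (a \<union> b) \<inter> d = {} \<and> 0 \<notin> a \<union> b \<and> int_of e a \<inter> int_of e b = {} \<and>
    (int_of e a \<union> int_of e b \<noteq> {} \<longrightarrow> Max (int_of e a \<union> int_of e b) \<in> int_of e a) \<and>
    osc e a b = n"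
proof (induction n)
  case 0
  interpret algebra X C by (fact C(1))
  have "X \<noteq> {}" by (auto simp: X_def)
  moreover have "osc e {} {} = 0" by (simp add: osc_def oscillate_at_def oscillates_from_def)
  ultimately show ?case
    by (intro exI[of _ "{}"] exI[of _ X]) simp
next
  case (Suc n)
  interpret algebra X C by (fact C(1))
  from Suc.IH obtain a b d where IH: "a \<in> C" "b \<in> C" "d \<in> C" "d \<noteq> {}"
    "a \<inter> b = {}" "(a \<union> b) \<inter> d = {}" "0 \<notin> a \<union> b" "int_of e a \<inter> int_of e b = {}"
    "int_of e a \<union> int_of e b \<noteq> {} \<longrightarrow> Max (int_of e a \<union> int_of e b) \<in> int_of e a"
    "osc e a b = n"
    by (elim exE conjE) (rule that)
  let ?A = "int_of e a" and ?B = "int_of e b"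
  \<comment> \<open>If \<open>?A \<union> ?B\<close> is empty, \<open>Max\<close> is unspecified,
    but any bound serves since there is then no element to exceed.\<close>
  obtain c where c: "c \<in> C" "c \<subset> d" "c \<noteq> {}" "0 \<notin> c" "\<forall>k\<in>int_of e c. Max (?A \<union> ?B) < k"
    using exists_subset_int_of_above[OF e C IH(3,4), of "Max (?A \<union> ?B)"]
    by (elim bexE conjE) (rule that)
  let ?K = "int_of e c"
  have above: "j < k" if "j \<in> ?A \<union> ?B" "k \<in> ?K" for j k
  proof -
    have "j \<le> Max (?A \<union> ?B)" by (rule Max_ge) (use that in auto)
    then show ?thesis using c(5) that(2) by (meson le_less_trans)
  qed
  have good: "good b" "good c" using IH(2) c(1) C(2) by (auto simp: good_sets_def)
  have K: "?K \<noteq> {}" using int_of_nonempty good(2) c(3) .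
  have BK: "?B \<inter> ?K = {}" "?A \<inter> ?K = {}" using above by blast+
  have "b \<inter> c = {}" using IH(6) c(2) by blast
  then have int: "int_of e (b \<union> c) = ?B \<union> ?K"
    using int_of_disjoint_Un good BK(1) by blast
  have pts: "osc_points (?B \<union> ?K) ?A = insert (Min ?K) (osc_points ?A ?B)"
    by (rule osc_points_append_block) (use K IH(8,9) above in auto)
  \<comment> \<open>The new point is outside both old sets, so the count grows by exactly
    one.\<close>
  have "Min ?K \<notin> ?A \<union> ?B" using BK Min_in[OF finite_int_of K] by blast
  then have "Min ?K \<notin> osc_points ?A ?B" using osc_points_subset by blast
  moreover have "finite (osc_points ?A ?B)"
    using osc_points_subset by (rule finite_subset) simp
  ultimately have "osc e (b \<union> c) a = Suc n"
    using IH(10) by (simp add: osc_eq_card_osc_points int pts)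
  \<comment> \<open>Invariant for the swapped pair: the nonempty block lies above \<open>?A\<close>,
    so the overall maximum is on the side that received it.\<close>
  moreover have "Max (?B \<union> ?K \<union> ?A) \<in> ?B \<union> ?K"
  proof -
    obtain k where k: "k \<in> ?K" using K by blast
    then have "k \<le> Max (?B \<union> ?K \<union> ?A)" by (intro Max_ge) auto
    then have "Max (?B \<union> ?K \<union> ?A) \<notin> ?A" using above k by (meson UnI1 leD)
    moreover have "Max (?B \<union> ?K \<union> ?A) \<in> ?B \<union> ?K \<union> ?A" using K by (intro Max_in) auto
    ultimately show ?thesis by blast
  qed
  moreover have "d - c \<noteq> {}" "d - c \<in> C" "b \<union> c \<in> C" using c IH by auto
  moreover have "(b \<union> c) \<inter> a = {}" "(b \<union> c \<union> a) \<inter> (d - c) = {}" "0 \<notin> b \<union> c \<union> a"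
    "int_of e (b \<union> c) \<inter> ?A = {}"
    using IH(5-8) c BK int by auto
  ultimately show ?case
    using IH(1) int
    by (intro exI[of _ "b \<union> c"] exI[of _ a] exI[of _ "d - c"] conjI) simp_all
qed

theorem theorem3p2:
  fixes e :: "rat \<Rightarrow> nat" and C :: "rat set set" and n :: nat
  assumes "finite_to_one_on (X \<union> {1}) e"
    and "algebra X C" and "C \<subseteq> good_sets"
    and "countable C" and "atomless C"
    and "n > 0"
  shows "\<exists>a\<in>C. \<exists>b\<in>C. a \<inter> b = {} \<and> 0 \<notin> a \<union> b \<and> osc e a b = n"
  using exists_disjoint_pair_osc[OF assms(1-3,5), of n] by blast

end
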